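(* Let $f\in F(n)$ be a derangement, i.e. a permutation of $\{0,1\}^n$ with no fixed point. Then there exists $h\in F(n)$ with $h\sim f$ such that $\mathcal{A}(h)$ is strongly connected.
   Context: $F(n)$ is the set of all functions $f:\{0,1\}^n\to\{0,1\}^n$, written $f=(f_1,\dots,f_n)$. $e_i$ is the configuration with a $1$ exactly in component $i$; addition is componentwise modulo $2$. The asynchronous graph $\mathcal{A}(f)$ is the digraph on $\{0,1\}^n$ with an arc from $x$ to $x+e_i$ whenever $f_i(x)\neq x_i$. $\mathcal{S}(f)$ has an arc $x\to f(x)$ for every $x$; $f\sim h$ means $\mathcal{S}(f)$ and $\mathcal{S}(h)$ are isomorphic. *)

theory Defs
  imports
    "HOL-Library.Z2"
    "HOL-Library.FuncSet"
    "Jordan_Normal_Form.Matrix"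
    "Graph_Theory.Graph_Theory"
begin

text \<open>
  A configuration in \<open>{0,1}\<^sup>n\<close> is an element of \<open>carrier_vec n :: bit vec set\<close>, so that
  \<open>+\<close> is componentwise addition modulo 2 and \<open>unit_vec n i\<close> is \<open>e\<^sub>i\<close>. Components are indexed
  by \<open>0, \<dots>, n - 1\<close>.
\<close>

definition boolean_networks :: "nat \<Rightarrow> (bit vec \<Rightarrow> bit vec) set" where
  "boolean_networks n = (carrier_vec n \<rightarrow>\<^sub>E carrier_vec n)"

definition async_graph :: "nat \<Rightarrow> (bit vec \<Rightarrow> bit vec) \<Rightarrow> bit vec pair_pre_digraph" where
  "async_graph n f =
     \<lparr>pverts = carrier_vec n,
      parcs = {(x, x + unit_vec n i) | x i. x \<in> carrier_vec n \<and> i < n \<and> f x $ i \<noteq> x $ i}\<rparr>"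

definition sync_graph :: "nat \<Rightarrow> (bit vec \<Rightarrow> bit vec) \<Rightarrow> bit vec pair_pre_digraph" where
  "sync_graph n f =
     \<lparr>pverts = carrier_vec n, parcs = {(x, f x) | x. x \<in> carrier_vec n}\<rparr>"

definition isomorphic_networks ::
    "nat \<Rightarrow> (bit vec \<Rightarrow> bit vec) \<Rightarrow> (bit vec \<Rightarrow> bit vec) \<Rightarrow> bool" where
  "isomorphic_networks n f h \<longleftrightarrow>
     digraph_iso (with_proj (sync_graph n f)) (with_proj (sync_graph n h))"

definition derangement :: "nat \<Rightarrow> (bit vec \<Rightarrow> bit vec) \<Rightarrow> bool" where
  "derangement n f \<longleftrightarrow>
     bij_betw f (carrier_vec n) (carrier_vec n) \<and> (\<forall>x \<in> carrier_vec n. f x \<noteq> x)"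

end

theory Submission
  imports Defs
begin

text \<open>
  Let \<open>M = 2\<^sup>n\<^sup>-\<^sup>1\<close>, identify configurations with numbers below \<open>2 * M\<close> in binary, and write
  \<open>V\<close> for the set of points of \<open>f\<close>. An inclusion-maximal \<open>S \<subseteq> V\<close> disjoint from
  \<open>f ` S\<close> leaves an even number \<open>2 * m\<close> of points outside \<open>S \<union> f ` S\<close>, all of which \<open>f\<close> maps
  into \<open>S\<close>; split them into \<open>P\<close> and \<open>Q\<close> of size \<open>m\<close>. Number \<open>P\<close> by \<open>{0..<m}\<close>, \<open>S\<close> by \<open>{m..<M}\<close>, and give \<open>f s\<close> the number antipodal to that
  of \<open>s\<close>. Then every configuration in \<open>{m..<M}\<close> has all outgoing arcs, those in \<open>{0..<m}\<close>
  have an arc to a larger number below \<open>M\<close>, and those in the upper half have an arc to the lower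
  half, except the \<open>f\<close>-predecessors of \<open>Q\<close>. These are numbered \<open>{M..<M + m}\<close> in such a way
  that each has all arcs inside the upper half; the set \<open>{M..<M + m}\<close> is then strongly connected,
  can be left through the second highest bit, and is entered from \<open>M + m\<close>, the number chosen for
  the predecessor of one point of \<open>P\<close>. Everything else is connected through \<open>M - 1\<close>.
\<close>

section \<open>Binary values of configurations\<close>

definition vec_val :: "bit vec \<Rightarrow> nat" where
  "vec_val x = (\<Sum>i<dim_vec x. of_bool (x $ i = 1) * 2 ^ i)"

lemma vec_val_carrier:
  "x \<in> carrier_vec n \<Longrightarrow> vec_val x = (\<Sum>i<n. of_bool (x $ i = 1) * 2 ^ i)"
  by (auto simp: vec_val_def)

lemma vec_val_horner_sum:
  assumes "x \<in> carrier_vec n"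
  shows "vec_val x = horner_sum of_bool 2 (map (\<lambda>i. x $ i = 1) [0..<n])"
  using assms by (simp add: vec_val_carrier horner_sum_eq_sum atLeast0LessThan)

lemma bij_betw_vec_val: "bij_betw vec_val (carrier_vec n) {..<2 ^ n}"
  unfolding bij_betw_def
proof
  show inj: "inj_on vec_val (carrier_vec n)"
  proof (rule inj_onI)
    fix x y assume xy: "x \<in> carrier_vec n" "y \<in> carrier_vec n" "vec_val x = vec_val y"
    have "x $ i = y $ i" if "i < n" for i
    proof -
      have "Bit_Operations.bit (vec_val z) i \<longleftrightarrow> z $ i = 1" if "z \<in> carrier_vec n" for z
        using \<open>i < n\<close> that by (simp add: vec_val_horner_sum bit_horner_sum_bit_iff)
      then show ?thesis using xy by (metis bit_not_one_iff)
    qed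
    then show "x = y" using xy by (intro eq_vecI) auto
  qed
  show "vec_val ` carrier_vec n = {..<2 ^ n}"
  proof (intro equalityI subsetI)
    fix k assume "k \<in> vec_val ` carrier_vec n"
    then obtain x where "x \<in> carrier_vec n" "k = vec_val x" by auto
    then show "k \<in> {..<2 ^ n}"
      using horner_sum_bound[of "map (\<lambda>i. x $ i = 1) [0..<n]", where 'a = nat]
      by (simp add: vec_val_horner_sum)
  next
    fix k :: nat assume k: "k \<in> {..<2 ^ n}"
    define x :: "bit vec" where "x = vec n (\<lambda>i. of_bool (Bit_Operations.bit k i))"
    have "map (\<lambda>i. x $ i = 1) [0..<n] = map (Bit_Operations.bit k) [0..<n]"
      by (auto simp: x_def)
    moreover have x: "x \<in> carrier_vec n" by (simp add: x_def)
    ultimately have "vec_val x = take_bit n k"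
      using vec_val_horner_sum[OF x] horner_sum_bit_eq_take_bit[of k n] by argo
    then have "vec_val x = k" using k by (simp add: take_bit_nat_eq_self_iff)
    then show "k \<in> vec_val ` carrier_vec n" using x by blast
  qed
qed

lemma vec_val_less: "x \<in> carrier_vec n \<Longrightarrow> vec_val x < 2 ^ n"
  using bij_betw_vec_val[of n] by (auto simp: bij_betw_def)

lemma vec_val_eq_iff:
  "x \<in> carrier_vec n \<Longrightarrow> y \<in> carrier_vec n \<Longrightarrow> vec_val x = vec_val y \<longleftrightarrow> x = y"
  using bij_betw_vec_val[of n] by (auto simp: bij_betw_def inj_on_def)

lemma ex_vec_val_eq:
  assumes "k < 2 ^ n"
  obtains x where "x \<in> carrier_vec n" "vec_val x = k"
  using assms bij_betw_vec_val[of n] unfolding bij_betw_def by (metis imageE lessThan_iff)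

text \<open>Otherwise each binary digit of \<open>y\<close> is at most that of \<open>x\<close>, and
  summing reverses the inequality. Comparing a configuration with a target thus yields a bit whose
  flip moves the value in the intended direction.\<close>

lemma vec_val_less_imp_ex:
  assumes "x \<in> carrier_vec n" "y \<in> carrier_vec n" "vec_val x < vec_val y"
  shows "\<exists>i<n. x $ i = 0 \<and> y $ i = 1"
proof (rule ccontr)
  assume "\<not> ?thesis"
  then have "vec_val y \<le> vec_val x"
    unfolding vec_val_carrier[OF assms(1)] vec_val_carrier[OF assms(2)]
    by (intro sum_mono) auto
  then show False using assms by simp
qed

lemma add_unit_vec_twice:
  "x \<in> carrier_vec n \<Longrightarrow> x + unit_vec n i + unit_vec n i = (x :: bit vec)"
  by (intro eq_vecI) (auto simp: add.assoc)

lemma vec_val_add_unit_vec_0: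
  assumes "x \<in> carrier_vec n" "i < n" "x $ i = 0"
  shows "vec_val (x + unit_vec n i) = vec_val x + 2 ^ i"
proof -
  have y: "x + unit_vec n i \<in> carrier_vec n" using assms by simp
  have "(\<Sum>j\<in>{..<n} - {i}. of_bool ((x + unit_vec n i) $ j = 1) * 2 ^ j)
      = (\<Sum>j\<in>{..<n} - {i}. of_bool (x $ j = 1) * 2 ^ j :: nat)"
    using assms by (intro sum.cong) auto
  then show ?thesis
    unfolding vec_val_carrier[OF assms(1)] vec_val_carrier[OF y]
    using assms by (subst (1 2) sum.remove[of "{..<n}" i]) (auto simp del: sum_mult_of_bool_eq)
qed

lemma vec_val_add_unit_vec_1:
  assumes "x \<in> carrier_vec n" "i < n" "x $ i = 1"
  shows "vec_val (x + unit_vec n i) + 2 ^ i = vec_val x"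
proof -
  have "x + unit_vec n i \<in> carrier_vec n" "(x + unit_vec n i) $ i = 0" using assms by simp_all
  then show ?thesis
    using vec_val_add_unit_vec_0[of "x + unit_vec n i" n i] assms
    by (simp only: add_unit_vec_twice)
qed

lemma vec_val_less_half_iff:
  assumes "x \<in> carrier_vec (Suc d)"
  shows "vec_val x < 2 ^ d \<longleftrightarrow> x $ d = 0"
proof -
  have "(\<Sum>i<d. of_bool (x $ i = 1) * 2 ^ i) < (2 ^ d :: nat)"
    using horner_sum_bound[of "map (\<lambda>i. x $ i = 1) [0..<d]", where 'a = nat]
    by (simp add: horner_sum_eq_sum atLeast0LessThan)
  then show ?thesis using assms by (cases "x $ d") (auto simp: vec_val_carrier)
qed

text \<open>A configuration and its bitwise complement have values adding up to
  \<open>2 ^ n - 1\<close>, so injectivity of \<open>vec_val\<close> makes \<open>y\<close> that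
  complement. With \<open>y = h x\<close>, all \<open>n\<close> arcs leave \<open>x\<close>.\<close>

lemma vec_val_complementary:
  assumes "x \<in> carrier_vec n" "y \<in> carrier_vec n" "vec_val x + vec_val y = 2 ^ n - 1" "i < n"
  shows "x $ i \<noteq> y $ i"
proof -
  define c where "c = vec n (\<lambda>i. x $ i + 1)"
  have c: "c \<in> carrier_vec n" by (simp add: c_def)
  have "vec_val x + vec_val c = (\<Sum>i<n. 2 ^ i)"
    unfolding vec_val_carrier[OF assms(1)] vec_val_carrier[OF c] sum.distrib[symmetric]
  proof (intro sum.cong refl)
    fix j assume "j \<in> {..<n}"
    then show "of_bool (x $ j = 1) * 2 ^ j + of_bool (c $ j = 1) * 2 ^ j = (2 ^ j :: nat)"
      by (cases "x $ j") (auto simp: c_def)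
  qed
  also have "\<dots> = 2 ^ n - 1" by (simp add: lessThan_atLeast0 sum_power2)
  finally have "y = c" using assms c by (simp add: vec_val_eq_iff[symmetric])
  then show ?thesis using assms(4) by (simp add: c_def)
qed

section \<open>A criterion for strong connectivity\<close>

lemma wf_digraph_async_graph: "wf_digraph (with_proj (async_graph n h))"
  by (rule wf_digraph.intro) (auto simp: async_graph_def)

lemma reachable_add_unit_vec:
  assumes "x \<in> carrier_vec n" "i < n" "h x $ i \<noteq> x $ i"
  shows "x \<rightarrow>\<^sup>*\<^bsub>with_proj (async_graph n h)\<^esub> (x + unit_vec n i)"
proof -
  interpret wf_digraph "with_proj (async_graph n h)" by (rule wf_digraph_async_graph)
  show ?thesis
    using assms by (intro reachable_adjI) (auto simp: async_graph_def arcs_ends_def arc_to_ends_def)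
qed

text \<open>The configuration \<open>t\<close> of value \<open>M - 1\<close> is a hub, reached from
  everywhere and reaching everything. The delicate part is the block \<open>{M..<M + m}\<close>,
  where the highest bit cannot be flipped; \<open>entry\<close> provides a way in.\<close>

lemma strongly_connected_async_graphI:
  fixes d m M :: nat and h :: "bit vec \<Rightarrow> bit vec"
  defines "V \<equiv> carrier_vec (Suc d)"
  assumes M: "M = 2 ^ d" and m: "2 * m \<le> M"
    and hV: "\<And>x. x \<in> V \<Longrightarrow> h x \<in> V"
    and antipodal: "\<And>x. x \<in> V \<Longrightarrow> m \<le> vec_val x \<Longrightarrow> vec_val x < M \<Longrightarrow>
      vec_val x + vec_val (h x) = 2 * M - 1"
    and upward: "\<And>x. x \<in> V \<Longrightarrow> vec_val x < m \<Longrightarrow> vec_val x < vec_val (h x) \<and> vec_val (h x) < M"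
    and semi_antipodal: "\<And>x. x \<in> V \<Longrightarrow> M \<le> vec_val x \<Longrightarrow> vec_val x < M + m \<Longrightarrow>
      vec_val x + vec_val (h x) = 3 * M - 1"
    and crossing: "\<And>x. x \<in> V \<Longrightarrow> M + m \<le> vec_val x \<Longrightarrow> vec_val (h x) < M"
    and entry: "\<And>x. x \<in> V \<Longrightarrow> m > 0 \<Longrightarrow> vec_val x = M + m \<Longrightarrow> vec_val (h x) < m"
  shows "strongly_connected (with_proj (async_graph (Suc d) h))"
proof -
  let ?G = "with_proj (async_graph (Suc d) h)"
  let ?e = "unit_vec (Suc d) :: nat \<Rightarrow> bit vec"
  interpret wf_digraph ?G by (rule wf_digraph_async_graph)
  have M0: "0 < M" by (simp add: M)
  have verts: "verts ?G = V" by (simp add: async_graph_def V_def)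
  have eV: "x + ?e i \<in> V" if "x \<in> V" for x i using that by (simp add: V_def)
  have twice: "x + ?e i + ?e i = x" if "x \<in> V" for x i
    using that add_unit_vec_twice unfolding V_def by blast
  have arc: "x \<rightarrow>\<^sup>*\<^bsub>?G\<^esub> (x + ?e i)" if "x \<in> V" "i \<le> d" "h x $ i \<noteq> x $ i" for x i
    using reachable_add_unit_vec[of x "Suc d" i h] that unfolding V_def by simp
  have bound: "vec_val x < 2 * M" if "x \<in> V" for x
    using vec_val_less[of x "Suc d"] that M by (simp add: V_def)
  have ex: "\<exists>x\<in>V. vec_val x = k" if "k < 2 * M" for k
    using ex_vec_val_eq[of k "Suc d"] that M unfolding V_def by auto
  have eq: "x = y" if "x \<in> V" "y \<in> V" "vec_val x = vec_val y" for x y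
    using vec_val_eq_iff that unfolding V_def by blast
  have half: "vec_val x < M \<longleftrightarrow> x $ d = 0" if "x \<in> V" for x
    using vec_val_less_half_iff that M unfolding V_def by blast
  have half': "M \<le> vec_val x \<longleftrightarrow> x $ d = 1" if "x \<in> V" for x
    using half[OF that] by (cases "x $ d") auto
  have less_ex: "\<exists>i\<le>d. x $ i = 0 \<and> y $ i = 1" if "x \<in> V" "y \<in> V" "vec_val x < vec_val y" for x y
    using vec_val_less_imp_ex[of x "Suc d" y] that unfolding V_def by (auto simp: less_Suc_eq_le)
  have val0: "vec_val (x + ?e i) = vec_val x + 2 ^ i" if "x \<in> V" "i \<le> d" "x $ i = 0" for x i
    using vec_val_add_unit_vec_0[of x "Suc d" i] that unfolding V_def by simp
  have val1: "vec_val (x + ?e i) + 2 ^ i = vec_val x" if "x \<in> V" "i \<le> d" "x $ i = 1" for x i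
    using vec_val_add_unit_vec_1[of x "Suc d" i] that unfolding V_def by simp
  have nth: "(x + ?e i) $ j = x $ j" if "x \<in> V" "i \<le> d" "j \<le> d" "i \<noteq> j" for x i j
    using that by (simp add: V_def)
  have nthd: "(x + ?e i) $ i = x $ i + 1" if "x \<in> V" "i \<le> d" for x i
    using that by (simp add: V_def)
  have full: "x \<rightarrow>\<^sup>*\<^bsub>?G\<^esub> (x + ?e i)" if "x \<in> V" "m \<le> vec_val x" "vec_val x < M" "i \<le> d" for x i
  proof (rule arc)
    have "vec_val x + vec_val (h x) = 2 ^ Suc d - 1" using antipodal[OF that(1-3)] M by simp
    then show "h x $ i \<noteq> x $ i"
      using vec_val_complementary[of x "Suc d" "h x" i] that hV[of x] unfolding V_def by simp
  qed (use that in auto)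
  \<comment> \<open>The sum \<open>3 * M - 1\<close> says that \<open>h x\<close> is the complement
    of \<open>x + ?e d\<close>, so only the arc in direction \<open>d\<close> is missing.\<close>
  have semi: "x \<rightarrow>\<^sup>*\<^bsub>?G\<^esub> (x + ?e i)" if "x \<in> V" "M \<le> vec_val x" "vec_val x < M + m" "i < d" for x i
  proof (rule arc)
    have "vec_val (x + ?e d) + M = vec_val x" using val1[of x d] half' that M by simp
    then have "vec_val (x + ?e d) + vec_val (h x) = 2 ^ Suc d - 1"
      using semi_antipodal[OF that(1-3)] M by simp
    then have "(x + ?e d) $ i \<noteq> h x $ i"
      using vec_val_complementary[of "x + ?e d" "Suc d" "h x" i] that hV[of x] eV[of x d]
      unfolding V_def by simp
    then show "h x $ i \<noteq> x $ i" using nth[of x d i] that by simp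
  qed (use that in auto)
  \<comment> \<open>A nonempty block forces \<open>m > 0\<close> and hence \<open>d > 0\<close>.
    Values below \<open>m\<close> do not use bit \<open>d - 1\<close>, and switching it on adds at
    least \<open>m\<close>, which leaves the block.\<close>
  have second_bit: "x $ (d - 1) = 0" "0 < d" "m \<le> 2 ^ (d - 1)"
    if "x \<in> V" "vec_val x < m \<or> M \<le> vec_val x \<and> vec_val x < M + m" for x
  proof -
    show d: "0 < d" using that m M by (cases d) auto
    then show dm: "m \<le> 2 ^ (d - 1)" using m M by (cases d) auto
    have small: "y $ (d - 1) = 0" if "y \<in> V" "vec_val y < m" for y
      using val1[of y "d - 1"] dm that d by (cases "y $ (d - 1)") auto
    show "x $ (d - 1) = 0"
    proof (cases "vec_val x < m")
      case False
      then have "vec_val (x + ?e d) < m" using val1[of x d] half' that M by auto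
      then show ?thesis using small[of "x + ?e d"] eV nth[of x d "d - 1"] that d by simp
    qed (use small that in auto)
  qed
  \<comment> \<open>Values below \<open>M\<close> have highest bit \<open>0\<close>, so the
    separating bit is lower and its flip stays in the lower half.\<close>
  have raise: "\<exists>i<d. x $ i = 0 \<and> y $ i = 1 \<and> vec_val x < vec_val (x + ?e i) \<and> vec_val (x + ?e i) < M"
    if xy: "x \<in> V" "y \<in> V" "vec_val x < vec_val y" "vec_val y < M" for x y
  proof -
    obtain i where i: "i \<le> d" "x $ i = 0" "y $ i = 1" using less_ex[of x y] xy by blast
    have "i \<noteq> d" using i half[of y] that by auto
    then show ?thesis
      using i half[of x] half[of "x + ?e i"] nth[of x i d] val0[of x i] eV that by (intro exI[of _ i]) auto
  qed
  obtain t where t: "t \<in> V" "vec_val t = M - 1"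
    using ex[of "M - 1"] less_imp_diff_less[of M "2 * M" 1] M0 by auto
  \<comment> \<open>Climbing: in \<open>{m..<M}\<close> every bit can be flipped, so
    \<open>t\<close> itself is the target; below \<open>m\<close> the larger value of
    \<open>h x\<close> supplies a bit that can be raised.\<close>
  have to_t_low: "x \<rightarrow>\<^sup>*\<^bsub>?G\<^esub> t" if "x \<in> V" "vec_val x < M" for x
    using that
  proof (induction "M - vec_val x" arbitrary: x rule: less_induct)
    case less
    show ?case
    proof (cases "vec_val x = M - 1")
      case True
      then show ?thesis using eq[of x t] t less.prems verts by auto
    next
      case False
      have "\<exists>i\<le>d. vec_val x < vec_val (x + ?e i) \<and> vec_val (x + ?e i) < M \<and> x \<rightarrow>\<^sup>*\<^bsub>?G\<^esub> (x + ?e i)"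
      proof (cases "m \<le> vec_val x")
        case True
        have "vec_val x < vec_val t" "vec_val t < M" using t False less.prems by linarith+
        then show ?thesis
          using raise[of x t] t(1) less.prems True full[of x] by (meson less_imp_le)
      next
        case False
        then have "\<exists>i<d. x $ i = 0 \<and> h x $ i = 1 \<and> vec_val x < vec_val (x + ?e i) \<and>
            vec_val (x + ?e i) < M"
          using raise[of x "h x"] upward[of x] hV less.prems by simp
        then obtain i where i: "i < d" "x $ i = 0" "h x $ i = 1" "vec_val x < vec_val (x + ?e i)"
          "vec_val (x + ?e i) < M" by blast
        then have "x \<rightarrow>\<^sup>*\<^bsub>?G\<^esub> (x + ?e i)" using arc[of x i] less.prems by simp
        then show ?thesis using i less_imp_le by blast
      qed
      then obtain i where i: "vec_val x < vec_val (x + ?e i)" "vec_val (x + ?e i) < M"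
        and step: "x \<rightarrow>\<^sup>*\<^bsub>?G\<^esub> (x + ?e i)" by blast
      have "(x + ?e i) \<rightarrow>\<^sup>*\<^bsub>?G\<^esub> t" using less.hyps[of "x + ?e i"] i less.prems eV by simp
      with step show ?thesis by (rule reachable_trans)
    qed
  qed
  have to_t_back: "x \<rightarrow>\<^sup>*\<^bsub>?G\<^esub> t" if "x \<in> V" "M + m \<le> vec_val x" for x
  proof -
    have "h x $ d = 0" "x $ d = 1" using crossing[of x] half[of "h x"] half'[of x] hV[of x] that by auto
    moreover from this have "vec_val (x + ?e d) < M" using half[of "x + ?e d"] eV nthd[of x d] that by simp
    ultimately show ?thesis
      using reachable_trans[OF arc[of x d] to_t_low[of "x + ?e d"]] eV that by simp
  qed
  have to_t: "x \<rightarrow>\<^sup>*\<^bsub>?G\<^esub> t" if "x \<in> V" for x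
  proof -
    consider "vec_val x < M" | "M \<le> vec_val x" "vec_val x < M + m" | "M + m \<le> vec_val x" by linarith
    then show ?thesis
    proof cases
      case 2
      then have "M + m \<le> vec_val (x + ?e (d - 1))"
        using second_bit[of x] val0[of x "d - 1"] that by auto
      then show ?thesis
        using reachable_trans[OF semi[of x "d - 1"] to_t_back[of "x + ?e (d - 1)"]]
          second_bit(2)[of x] eV that 2 by simp
    qed (use to_t_low to_t_back that in auto)
  qed
  \<comment> \<open>The path is built backwards: raising a bit of \<open>x\<close> towards
    \<open>t\<close> stays in \<open>{m..<M}\<close>, where all arcs exist, including the one back
    to \<open>x\<close>.\<close>
  have from_t_F: "t \<rightarrow>\<^sup>*\<^bsub>?G\<^esub> x" if "x \<in> V" "m \<le> vec_val x" "vec_val x < M" for x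
    using that
  proof (induction "M - vec_val x" arbitrary: x rule: less_induct)
    case less
    show ?case
    proof (cases "vec_val x = M - 1")
      case True
      then show ?thesis using eq[of x t] t less.prems verts by auto
    next
      case False
      then have "vec_val x < vec_val t" "vec_val t < M" using t less.prems by linarith+
      then obtain i where i: "i < d" "vec_val x < vec_val (x + ?e i)" "vec_val (x + ?e i) < M"
        using raise[of x t] t(1) less.prems by blast
      then have "t \<rightarrow>\<^sup>*\<^bsub>?G\<^esub> (x + ?e i)" using less eV by auto
      moreover have "(x + ?e i) \<rightarrow>\<^sup>*\<^bsub>?G\<^esub> x"
        using full[of "x + ?e i" i] twice[of x i] i less.prems eV by simp
      ultimately show ?thesis by (rule reachable_trans)
    qed
  qed
  have from_t_low: "t \<rightarrow>\<^sup>*\<^bsub>?G\<^esub> x" if "x \<in> V" "vec_val x < M" for x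
  proof (cases "m \<le> vec_val x")
    case False
    let ?y = "x + ?e (d - 1)"
    have y: "?y \<in> V" "m \<le> vec_val ?y" "vec_val ?y < M"
      using False second_bit[of x] val0[of x "d - 1"] half[of x] half[of ?y] nth[of x "d - 1" d] eV that
      by auto
    show ?thesis
      using reachable_trans[OF from_t_F[OF y] full[OF y, of "d - 1"]] twice[of x "d - 1"] that by simp
  qed (use from_t_F that in auto)
  \<comment> \<open>Switching off the highest bit lands in \<open>{m..<M}\<close>, where the arc
    restoring it exists.\<close>
  have from_t_back: "t \<rightarrow>\<^sup>*\<^bsub>?G\<^esub> x" if "x \<in> V" "M + m \<le> vec_val x" for x
  proof -
    let ?y = "x + ?e d"
    have y: "?y \<in> V" "m \<le> vec_val ?y" "vec_val ?y < M"
      using val1[of x d] half'[of x] bound[of x] eV that M by auto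
    show ?thesis
      using reachable_trans[OF from_t_F[OF y] full[OF y, of d]] twice[of x d] that by simp
  qed
  \<comment> \<open>\<open>b\<close> has only the highest bit set. Any other member of the block
    descends to it bit by bit inside the block, and each of these arcs has its reverse.\<close>
  obtain b where b: "b \<in> V" "vec_val b = M" using ex[of M] M0 by auto
  have lower: "\<exists>i<d. M \<le> vec_val (x + ?e i) \<and> vec_val (x + ?e i) < vec_val x"
    if x: "x \<in> V" "M < vec_val x" for x
  proof -
    obtain i where i: "i \<le> d" "b $ i = 0" "x $ i = 1" using less_ex[of b x] b x by auto
    have "i \<noteq> d" using i half'[of b] b by auto
    then have "i < d" using i by simp
    moreover have "M \<le> vec_val (x + ?e i)"
      using i \<open>i \<noteq> d\<close> half'[of x] half'[of "x + ?e i"] nth[of x i d] eV[of x i] x by simp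
    moreover have "vec_val (x + ?e i) < vec_val x"
      using val1[of x i] i x by (metis less_add_same_cancel1 zero_less_numeral zero_less_power)
    ultimately show ?thesis by blast
  qed
  have via_b: "x \<rightarrow>\<^sup>*\<^bsub>?G\<^esub> b \<and> b \<rightarrow>\<^sup>*\<^bsub>?G\<^esub> x" if "x \<in> V" "M \<le> vec_val x" "vec_val x < M + m" for x
    using that
  proof (induction "vec_val x" arbitrary: x rule: less_induct)
    case less
    show ?case
    proof (cases "vec_val x = M")
      case True
      then show ?thesis using eq[of x b] b less.prems verts by auto
    next
      case False
      then obtain i where i: "i < d" "M \<le> vec_val (x + ?e i)" "vec_val (x + ?e i) < vec_val x"
        using lower[of x] less.prems by auto
      let ?y = "x + ?e i"
      have "?y \<rightarrow>\<^sup>*\<^bsub>?G\<^esub> b" "b \<rightarrow>\<^sup>*\<^bsub>?G\<^esub> ?y" using less i eV by auto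
      moreover have "?y \<rightarrow>\<^sup>*\<^bsub>?G\<^esub> x"
        using semi[of ?y i] twice[of x i] i less.prems eV by simp
      moreover have "x \<rightarrow>\<^sup>*\<^bsub>?G\<^esub> ?y" using semi[of x i] i less.prems by simp
      ultimately show ?thesis using reachable_trans by blast
    qed
  qed
  have from_t_semi: "t \<rightarrow>\<^sup>*\<^bsub>?G\<^esub> x" if "x \<in> V" "M \<le> vec_val x" "vec_val x < M + m" for x
  proof -
    have "m > 0" using that by simp
    \<comment> \<open>\<open>c\<close> is the first configuration beyond the block. Without its
      highest bit its value \<open>m\<close> still exceeds that of \<open>h c\<close>, so some lower
      bit can be switched off, and this descends into the block.\<close>
    obtain c where c: "c \<in> V" "vec_val c = M + m" using ex[of "M + m"] m \<open>m > 0\<close> by auto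
    have "vec_val (c + ?e d) = m" using val1[of c d] half'[of c] c M by simp
    then obtain i where i: "i \<le> d" "h c $ i = 0" "(c + ?e d) $ i = 1"
      using less_ex[of "h c" "c + ?e d"] entry[of c] c \<open>m > 0\<close> hV eV by auto
    have "c $ d = 1" using half'[of c] c by simp
    then have "i \<noteq> d" using i nthd[of c d] c by auto
    then have ci: "c $ i = 1" using i nth[of c d i] c by simp
    have "M \<le> vec_val (c + ?e i)"
      using half'[of "c + ?e i"] eV c \<open>c $ d = 1\<close> \<open>i \<noteq> d\<close> i nth[of c i d] by simp
    moreover have "vec_val (c + ?e i) < M + m" using val1[of c i] ci c i
      by (metis less_add_same_cancel1 zero_less_numeral zero_less_power)
    ultimately have "(c + ?e i) \<rightarrow>\<^sup>*\<^bsub>?G\<^esub> x"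
      using via_b[of "c + ?e i"] via_b[of x] eV c that reachable_trans by blast
    moreover have "c \<rightarrow>\<^sup>*\<^bsub>?G\<^esub> (c + ?e i)" using arc[of c i] c i ci by simp
    moreover have "t \<rightarrow>\<^sup>*\<^bsub>?G\<^esub> c" using from_t_back[of c] c by simp
    ultimately show ?thesis using reachable_trans by blast
  qed
  have from_t: "t \<rightarrow>\<^sup>*\<^bsub>?G\<^esub> x" if "x \<in> V" for x
    using that from_t_low from_t_back from_t_semi by (meson not_le)
  show ?thesis
    unfolding strongly_connected_def verts
    using t to_t from_t reachable_trans by blast
qed

section \<open>Labelling the points of a derangement\<close>

lemma ex_bij_betw_extension:
  assumes "finite S" "finite T" "card S = card T" "A \<subseteq> S" "inj_on u A" "u ` A \<subseteq> T"
  obtains v where "bij_betw v S T" "\<And>x. x \<in> A \<Longrightarrow> v x = u x"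
proof -
  have "card (S - A) = card (T - u ` A)"
    using assms by (simp add: card_Diff_subset card_image finite_subset[of A S])
  then obtain w where w: "bij_betw w (S - A) (T - u ` A)"
    using assms finite_same_card_bij[of "S - A" "T - u ` A"] by auto
  define v where "v x = (if x \<in> A then u x else w x)" for x
  have "bij_betw v A (u ` A)" using assms(5) by (simp add: v_def bij_betw_def cong: inj_on_cong)
  moreover have "bij_betw v (S - A) (T - u ` A)"
    using w by (subst bij_betw_cong[of _ v w]) (auto simp: v_def)
  ultimately have "bij_betw v (A \<union> (S - A)) (u ` A \<union> (T - u ` A))"
    by (rule bij_betw_combine) auto
  then show thesis using that[of v] assms(4,6) by (simp add: v_def Un_absorb1)
qed

text \<open>Take \<open>S\<close> maximal among the subsets disjoint from their image. If
  \<open>x\<close> were outside \<open>S\<close> and its image with \<open>f x\<close> outside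
  \<open>S\<close>, then \<open>insert x S\<close> would also be disjoint from its image, because
  \<open>f x \<noteq> x\<close>.\<close>

lemma ex_alternating_subset:
  assumes "finite V" "\<And>x. x \<in> V \<Longrightarrow> f x \<noteq> x"
  obtains S where "S \<subseteq> V" "S \<inter> f ` S = {}" "f ` (V - S - f ` S) \<subseteq> S"
proof -
  define F where "F = {S. S \<subseteq> V \<and> S \<inter> f ` S = {}}"
  have "finite F" using assms(1) by (simp add: F_def)
  moreover have "{} \<in> F" by (simp add: F_def)
  ultimately have "\<exists>S\<in>F. \<forall>T\<in>F. S \<subseteq> T \<longrightarrow> S = T" by (intro finite_has_maximal) auto
  then obtain S where S: "S \<in> F" and max: "\<forall>T\<in>F. S \<subseteq> T \<longrightarrow> S = T" by (elim bexE)
  have "f x \<in> S" if x: "x \<in> V - S - f ` S" for x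
  proof (rule ccontr)
    assume "f x \<notin> S"
    then have "insert x S \<in> F" using S x assms(2)[of x] by (auto simp: F_def)
    then have "S = insert x S" using max by (simp add: subset_insertI)
    then show False using x by auto
  qed
  then show thesis using that[of S] S by (auto simp: F_def)
qed

text \<open>\<open>P\<close>, \<open>S\<close>, the image of \<open>S\<close>, and \<open>Q\<close>
  receive the consecutive intervals \<open>{..<m}\<close>, \<open>{m..<M}\<close>,
  \<open>{M..<2 * M - m}\<close> and \<open>{2 * M - m..<2 * M}\<close>. The labels inside
  \<open>S\<close> are tuned so that the predecessor of \<open>q\<close> in \<open>Q\<close> gets
  \<open>M + b q\<close>, which matches \<open>2 * M - 1 - b q\<close>.\<close>

lemma ex_labelling:
  fixes f :: "'a \<Rightarrow> 'a"
  assumes V: "finite V" "card V = 2 * M" and f: "bij_betw f V V" "\<And>x. x \<in> V \<Longrightarrow> f x \<noteq> x"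
  obtains g m where "bij_betw g V {..<2 * M}" "2 * m \<le> M"
    "\<And>x. x \<in> V \<Longrightarrow> m \<le> g x \<Longrightarrow> g x < M \<Longrightarrow> g x + g (f x) = 2 * M - 1"
    "\<And>x. x \<in> V \<Longrightarrow> g x < m \<Longrightarrow> g x < g (f x) \<and> g (f x) < M"
    "\<And>x. x \<in> V \<Longrightarrow> M \<le> g x \<Longrightarrow> g x < M + m \<Longrightarrow> g x + g (f x) = 3 * M - 1"
    "\<And>x. x \<in> V \<Longrightarrow> M + m \<le> g x \<Longrightarrow> g (f x) < M"
    "\<And>x. x \<in> V \<Longrightarrow> m > 0 \<Longrightarrow> g x = M + m \<Longrightarrow> g (f x) < m"
proof -
  have fV: "f x \<in> V" if "x \<in> V" for x using f(1) that by (auto simp: bij_betw_def)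
  have inj: "inj_on f V" using f(1) by (simp add: bij_betw_def)
  obtain S where S: "S \<subseteq> V" "S \<inter> f ` S = {}" "f ` (V - S - f ` S) \<subseteq> S"
    using ex_alternating_subset[OF V(1) f(2)] by blast
  define U where "U = V - S - f ` S"
  have UV: "U \<subseteq> V" "S \<inter> U = {}" "f ` S \<inter> U = {}" "V = U \<union> S \<union> f ` S"
    using S(1) fV by (auto simp: U_def)
  have fU: "f x \<in> S" if "x \<in> U" for x using S(3) that by (auto simp: U_def)
  have fin: "finite S" "finite U" using V(1) S(1) UV(1) finite_subset by auto
  have "card V = card U + card S + card (f ` S)"
    using UV S fin by (simp add: card_Un_disjoint Int_Un_distrib2 Int_commute)
  moreover have "card (f ` S) = card S" using inj S(1) card_image inj_on_subset by metis
  ultimately have cU: "card U + 2 * card S = 2 * M" using V(2) by simp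
  define m where "m = card U div 2"
  have cardU: "card U = 2 * m" using cU unfolding m_def by presburger
  have cardS: "card S + m = M" using cU cardU by simp
  \<comment> \<open>\<open>f\<close> embeds \<open>U\<close> into \<open>S\<close>, so
    \<open>2 * m \<le> card S = M - m\<close>.\<close>
  have "card U \<le> card S"
    using card_mono[of S "f ` U"] card_image[of f U] inj_on_subset[OF inj UV(1)] fU fin by fastforce
  then have m3: "3 * m \<le> M" using cardU cardS by simp
  obtain P where P: "P \<subseteq> U" "card P = m"
    using obtain_subset_with_card_n[of m U] cardU by auto
  define Q where "Q = U - P"
  have PQ: "P \<inter> Q = {}" "P \<union> Q = U" "card Q = m" "finite P" "finite Q"
    using P fin cardU by (auto simp: Q_def card_Diff_subset finite_subset)
  obtain a where a: "bij_betw a P {..<m}"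
    using ex_bij_betw_finite_nat[of P] PQ P(2) by (auto simp: atLeast0LessThan)
  obtain b where b: "bij_betw b Q {..<m}"
    using ex_bij_betw_finite_nat[of Q] PQ by (auto simp: atLeast0LessThan)
  have bm: "b q < m" if "q \<in> Q" for q using b that by (auto simp: bij_betw_def)
  \<comment> \<open>The predecessor of \<open>c\<close> is to be labelled \<open>M + j c\<close>.
    \<open>C\<close> consists of \<open>Q\<close> with offsets \<open>b\<close> and, if
    \<open>m > 0\<close>, one point of \<open>P\<close> with offset \<open>m\<close>, which produces
    the entry from \<open>M + m\<close>.\<close>
  have "\<exists>C j. Q \<subseteq> C \<and> C \<subseteq> U \<and> inj_on j C \<and> j ` C \<subseteq> {..m} \<and> (\<forall>q\<in>Q. j q = b q) \<and>
      (m > 0 \<longrightarrow> (\<exists>p\<in>C \<inter> P. j p = m))"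
  proof (cases "m = 0")
    case True
    then show ?thesis
      using b PQ by (intro exI[of _ Q] exI[of _ b]) (auto simp: bij_betw_def)
  next
    case False
    then obtain p where p: "p \<in> P" using P(2) by fastforce
    then have "p \<notin> Q" using PQ by blast
    then have "inj_on (b(p := m)) (insert p Q)"
      using b bm by (auto simp: bij_betw_def inj_on_def)
    then show ?thesis
      using b bm p PQ \<open>p \<notin> Q\<close>
      by (intro exI[of _ "insert p Q"] exI[of _ "b(p := m)"]) (auto intro: less_imp_le)
  qed
  then obtain C j where C: "Q \<subseteq> C" "C \<subseteq> U" and j: "inj_on j C" "j ` C \<subseteq> {..m}" "\<And>q. q \<in> Q \<Longrightarrow> j q = b q"
    and jp: "m > 0 \<Longrightarrow> \<exists>p\<in>C \<inter> P. j p = m" by blast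
  have jm: "j c \<le> m" if "c \<in> C" for c using j(2) that by auto
  \<comment> \<open>The predecessor of \<open>c = f (f s)\<close> is \<open>f s\<close>; by
    antipodality it gets the label \<open>M + j c\<close> exactly when \<open>s\<close> gets
    \<open>M - 1 - j c\<close>.\<close>
  define A where "A = {s \<in> S. f (f s) \<in> C}"
  define u where "u s = M - 1 - j (f (f s))" for s
  have AS: "A \<subseteq> S" by (auto simp: A_def)
  \<comment> \<open>Strictness gives \<open>m \<le> M - 1 - j c\<close> even for
    \<open>j c = m\<close>, so the prescribed labels fit into \<open>{m..<M}\<close>.\<close>
  have m2: "2 * m < M" if "A \<noteq> {}"
  proof -
    have "S \<noteq> {}" using AS that by auto
    then have "card S > 0" using fin by (simp add: card_gt_0_iff)
    then show ?thesis using cardS m3 by simp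
  qed
  have "inj_on u A"
  proof (rule inj_onI)
    fix s s' assume s: "s \<in> A" "s' \<in> A" "u s = u s'"
    then have "2 * m < M" using m2 by blast
    then have "j (f (f s)) = j (f (f s'))"
      using s jm[of "f (f s)"] jm[of "f (f s')"] by (auto simp: u_def A_def)
    then have "f (f s) = f (f s')" using s j(1) by (auto simp: A_def inj_on_def)
    then show "s = s'" using inj s S(1) fV by (auto simp: A_def inj_on_def subset_iff)
  qed
  moreover have "u ` A \<subseteq> {m..<M}"
  proof
    fix k assume "k \<in> u ` A"
    then obtain s where s: "s \<in> A" "k = u s" by blast
    then have "2 * m < M" using m2 by blast
    then show "k \<in> {m..<M}" using s jm[of "f (f s)"] by (auto simp: u_def A_def)
  qed
  moreover have "card S = card {m..<M}" using cardS by simp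
  ultimately obtain v where v: "bij_betw v S {m..<M}" "\<And>s. s \<in> A \<Longrightarrow> v s = u s"
    using ex_bij_betw_extension[OF fin(1) finite_atLeastLessThan _ AS] by metis
  have vr: "m \<le> v s" "v s < M" if "s \<in> S" for s using v(1) that by (auto simp: bij_betw_def)
  \<comment> \<open>On \<open>V\<close> the last branch concerns the image of \<open>S\<close>:
    \<open>inv_into V f\<close> recovers \<open>s\<close> from \<open>f s\<close>, which gets the
    label antipodal to \<open>v s\<close>.\<close>
  define g where "g x = (if x \<in> P then a x else if x \<in> S then v x
    else if x \<in> Q then 2 * M - 1 - b x else 2 * M - 1 - v (inv_into V f x))" for x
  have gP: "g x = a x" "g x < m" if "x \<in> P" for x using a that by (auto simp: g_def bij_betw_def)
  have gS: "g x = v x" "m \<le> g x" "g x < M" if "x \<in> S" for x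
    using that vr[of x] UV PQ by (auto simp: g_def)
  have gQ: "g x = 2 * M - 1 - b x" if "x \<in> Q" for x using that UV PQ by (auto simp: g_def)
  have gfS: "g (f s) = 2 * M - 1 - v s" if "s \<in> S" for s
  proof -
    have "f s \<notin> P" "f s \<notin> S" "f s \<notin> Q" using that UV PQ S by auto
    then show ?thesis using that inj S(1) by (auto simp: g_def inv_into_f_f subset_iff)
  qed
  have "bij_betw g P {..<m}" using a gP(1) by (simp cong: bij_betw_cong)
  moreover have "bij_betw g S {m..<M}" using v(1) gS(1) by (simp cong: bij_betw_cong)
  ultimately have "bij_betw g (P \<union> S) ({..<m} \<union> {m..<M})"
    by (rule bij_betw_combine) auto
  moreover have "bij_betw g (f ` S) {M..<2 * M - m}"
  proof -
    have "bij_betw (\<lambda>k. 2 * M - 1 - k) {m..<M} {M..<2 * M - m}"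
      by (rule bij_betw_byWitness[where f' = "\<lambda>k. 2 * M - 1 - k"]) auto
    then have "bij_betw ((\<lambda>k. 2 * M - 1 - k) \<circ> v) S {M..<2 * M - m}"
      using v(1) bij_betw_trans by blast
    then have "bij_betw (g \<circ> f) S {M..<2 * M - m}"
      by (rule iffD1[OF bij_betw_cong, rotated]) (simp add: gfS)
    moreover have "bij_betw f S (f ` S)" using inj S(1) by (meson bij_betw_imageI inj_on_subset)
    ultimately show ?thesis using bij_betw_comp_iff by blast
  qed
  ultimately have "bij_betw g (P \<union> S \<union> f ` S) ({..<m} \<union> {m..<M} \<union> {M..<2 * M - m})"
    by (rule bij_betw_combine) auto
  moreover have "bij_betw g Q {2 * M - m..<2 * M}"
  proof -
    have "bij_betw (\<lambda>k. 2 * M - 1 - k) {..<m} {2 * M - m..<2 * M}"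
      using m3 by (intro bij_betw_byWitness[where f' = "\<lambda>k. 2 * M - 1 - k"]) auto
    then have "bij_betw ((\<lambda>k. 2 * M - 1 - k) \<circ> b) Q {2 * M - m..<2 * M}"
      using b bij_betw_trans by blast
    then show ?thesis
      by (rule iffD1[OF bij_betw_cong, rotated]) (simp add: gQ)
  qed
  ultimately have "bij_betw g (P \<union> S \<union> f ` S \<union> Q)
      ({..<m} \<union> {m..<M} \<union> {M..<2 * M - m} \<union> {2 * M - m..<2 * M})"
    by (rule bij_betw_combine) (use m3 in auto)
  moreover have "P \<union> S \<union> f ` S \<union> Q = V" using UV(4) PQ(2) by blast
  moreover have "{..<m} \<union> {m..<M} \<union> {M..<2 * M - m} \<union> {2 * M - m..<2 * M} = {..<2 * M}"
    using m3 by auto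
  ultimately have gbij: "bij_betw g V {..<2 * M}" by simp
  have cases: "x \<in> P \<or> x \<in> S \<or> x \<in> Q \<or> x \<in> f ` S" if "x \<in> V" for x
    using that UV(4) PQ(2) by blast
  \<comment> \<open>A nonempty \<open>Q\<close> forces \<open>m > 0\<close>, so
    \<open>3 * m \<le> M\<close> gives \<open>2 * m < M\<close>.\<close>
  have gQr: "M + m < g x" if "x \<in> Q" for x using gQ[OF that] bm[OF that] m3 by auto
  have gfSr: "M \<le> g x" if "x \<in> f ` S" for x using that gfS vr by fastforce
  \<comment> \<open>The predecessor of \<open>q\<close> is not in \<open>S\<close>, since
    \<open>U\<close> avoids the image of \<open>S\<close>, and not in \<open>U\<close>, since
    \<open>f\<close> sends \<open>U\<close> into \<open>S\<close>.\<close>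
  have two_back: "\<exists>s\<in>S. q = f (f s)" if q: "q \<in> U" for q
  proof -
    obtain w where w: "w \<in> V" "q = f w" using f(1) q UV(1) by (auto simp: bij_betw_def)
    have "w \<notin> S" "w \<notin> U" using w q UV(2,3) fU[of w] by auto
    then show ?thesis using w UV(4) by blast
  qed
  \<comment> \<open>This inverts the prescription \<open>u\<close>: by injectivity of
    \<open>v\<close>, the label \<open>M + j c\<close> can only belong to the predecessor of
    \<open>c\<close>.\<close>
  have label_back: "\<exists>s\<in>S. x = f s \<and> f (f s) = c" if c: "x \<in> V" "c \<in> C" "g x = M + j c" for x c
  proof -
    have "g x \<le> M + m" using that jm by simp
    then have "x \<in> f ` S" using cases[of x] gP(2)[of x] gS(3)[of x] gQr[of x] m3 that by fastforce
    then obtain s where s: "s \<in> S" "x = f s" by blast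
    obtain s' where s': "s' \<in> S" "c = f (f s')" using two_back c C by blast
    then have "s' \<in> A" using that by (simp add: A_def)
    then have "v s' = M - 1 - j c" using v(2) s' by (simp add: u_def)
    moreover have "v s = M - 1 - j c" using gfS[of s] vr[of s] s that by auto
    ultimately have "s = s'" using v(1) s s' by (metis bij_betw_inv_into_left)
    then show ?thesis using s s' by blast
  qed
  show thesis
  proof (rule that[OF gbij, of m])
    show "2 * m \<le> M" using m3 by simp
    fix x assume x: "x \<in> V"
    show "g x + g (f x) = 2 * M - 1" if "m \<le> g x" "g x < M"
    proof -
      have "x \<in> S" using cases[OF x] gP(2)[of x] gQr[of x] gfSr[of x] that by auto
      then show ?thesis using gS(1)[of x] gfS[of x] vr[of x] by simp
    qed
    show "g x < g (f x) \<and> g (f x) < M" if "g x < m"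
    proof -
      have "x \<in> P" using cases[OF x] gS(2)[of x] gQr[of x] gfSr[of x] m3 that by auto
      then show ?thesis using gS[of "f x"] fU[of x] P(1) that by auto
    qed
    show "g x + g (f x) = 3 * M - 1" if gx: "M \<le> g x" "g x < M + m"
    proof -
      have "g x - M \<in> b ` Q" using b that by (auto simp: bij_betw_def)
      then obtain q where q: "q \<in> Q" "b q = g x - M" by auto
      then obtain s where "x = f s" "f (f s) = q" using label_back[OF x, of q] C j(3) gx by auto
      then show ?thesis using gQ[of q] q that m3 by auto
    qed
    show "g (f x) < m" if gx: "m > 0" "g x = M + m"
    proof -
      obtain p where p: "p \<in> C" "p \<in> P" "j p = m" using jp \<open>m > 0\<close> by blast
      then obtain s where "x = f s" "f (f s) = p" using label_back[OF x, of p] gx by auto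
      then show ?thesis using gP(2) p by simp
    qed
    show "g (f x) < M" if "M + m \<le> g x"
    proof (cases "x \<in> Q")
      case True
      then show ?thesis using gS(3)[of "f x"] fU[of x] PQ by auto
    next
      case False
      then have "x \<in> f ` S" using cases[OF x] gP(2)[of x] gS(3)[of x] m3 that by auto
      then obtain s where s: "s \<in> S" "x = f s" by blast
      \<comment> \<open>Predecessors of points of \<open>Q\<close> were labelled below
        \<open>M + m\<close>.\<close>
      have "f x \<notin> Q"
      proof
        assume q: "f x \<in> Q"
        then have "s \<in> A" using s C by (auto simp: A_def)
        then have "v s = M - 1 - b (f x)" using v(2) s q j(3) by (simp add: u_def)
        then show False using gfS[of s] s that bm[OF q] m3 by auto
      qed
      moreover have "f x \<notin> f ` S"
      proof
        assume "f x \<in> f ` S"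
        then obtain s' where s': "s' \<in> S" "f x = f s'" by blast
        then have "x = s'" using inj_onD[OF inj, of x s'] x S(1) by blast
        then show False using s s' S(2) by blast
      qed
      ultimately show ?thesis
        using cases[OF fV[OF x]] gP(2)[of "f x"] gS(3)[of "f x"] m3 by auto
    qed
  qed
qed

section \<open>Conjugating the network\<close>

text \<open>Arcs here are pairs, so \<open>\<psi>\<close> acts on them by \<open>map_prod\<close>.
  Conjugacy sends \<open>(x, h x)\<close> to \<open>(\<psi> x, f (\<psi> x))\<close>, and
  surjectivity of \<open>\<psi>\<close> yields every arc for \<open>f\<close>.\<close>

lemma isomorphic_networksI:
  assumes "bij_betw \<psi> (carrier_vec n) (carrier_vec n)"
    and "\<And>x. x \<in> carrier_vec n \<Longrightarrow> h x \<in> carrier_vec n"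
    and "\<And>x. x \<in> carrier_vec n \<Longrightarrow> \<psi> (h x) = f (\<psi> x)"
  shows "isomorphic_networks n h f"
proof -
  let ?V = "carrier_vec n :: bit vec set"
  let ?hom = "\<lparr>iso_verts = \<psi>, iso_arcs = map_prod \<psi> \<psi>, iso_head = snd, iso_tail = fst\<rparr>"
  have inj: "inj_on \<psi> ?V" and img: "\<psi> ` ?V = ?V" using assms(1) by (auto simp: bij_betw_def)
  have "wf_digraph (with_proj (sync_graph n h))"
    by (rule wf_digraph.intro) (auto simp: sync_graph_def assms(2))
  moreover have "inj_on (map_prod \<psi> \<psi>) {(x, h x) |x. x \<in> ?V}"
    using inj by (auto simp: inj_on_def)
  ultimately have "pre_digraph.digraph_isomorphism (with_proj (sync_graph n h)) ?hom"
    using inj by (auto simp: pre_digraph.digraph_isomorphism_def sync_graph_def)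
  moreover have "map_prod \<psi> \<psi> ` {(x, h x) |x. x \<in> ?V} = {(x, f x) |x. x \<in> ?V}"
  proof -
    have "map_prod \<psi> \<psi> ` {(x, h x) |x. x \<in> ?V} = {(\<psi> x, f (\<psi> x)) |x. x \<in> ?V}"
      using assms(3) by (force simp: image_iff)
    also have "\<dots> = {(y, f y) |y. y \<in> \<psi> ` ?V}" by blast
    finally show ?thesis by (simp add: img)
  qed
  then have "with_proj (sync_graph n f) = app_iso ?hom (with_proj (sync_graph n h))"
    using img by (auto simp: app_iso_def sync_graph_def with_proj_def)
  ultimately show ?thesis unfolding isomorphic_networks_def digraph_iso_def by blast
qed

theorem theorem5:
  fixes n :: nat and f :: "bit vec \<Rightarrow> bit vec"
  assumes "f \<in> boolean_networks n"
    and "derangement n f"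
  shows "\<exists>h \<in> boolean_networks n.
           isomorphic_networks n h f \<and> strongly_connected (with_proj (async_graph n h))"
proof (cases n)
  case 0
  \<comment> \<open>The only configuration of dimension 0 would be a fixed point, so there is no
    derangement.\<close>
  have "0\<^sub>v n \<in> carrier_vec n" "f (0\<^sub>v n) \<in> carrier_vec n"
    using assms(1) PiE_mem[of f "carrier_vec n"] unfolding boolean_networks_def by auto
  then have "f (0\<^sub>v n) = 0\<^sub>v n" using 0 by (intro eq_vecI) auto
  then show ?thesis using assms(2) zero_carrier_vec[of n] unfolding derangement_def by blast
next
  case (Suc d)
  let ?V = "carrier_vec (Suc d) :: bit vec set"
  define M :: nat where "M = 2 ^ d"
  have val: "bij_betw vec_val ?V {..<2 * M}" using bij_betw_vec_val[of "Suc d"] by (simp add: M_def)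
  have f: "bij_betw f ?V ?V" "\<And>x. x \<in> ?V \<Longrightarrow> f x \<noteq> x"
    using assms(2) Suc by (auto simp: derangement_def)
  have fin: "finite ?V" using bij_betw_finite[OF val] by simp
  have card: "card ?V = 2 * M" using bij_betw_same_card[OF val] by simp
  obtain g m where g: "bij_betw g ?V {..<2 * M}" and m: "2 * m \<le> M"
    and lab: "\<And>x. x \<in> ?V \<Longrightarrow> m \<le> g x \<Longrightarrow> g x < M \<Longrightarrow> g x + g (f x) = 2 * M - 1"
    "\<And>x. x \<in> ?V \<Longrightarrow> g x < m \<Longrightarrow> g x < g (f x) \<and> g (f x) < M"
    "\<And>x. x \<in> ?V \<Longrightarrow> M \<le> g x \<Longrightarrow> g x < M + m \<Longrightarrow> g x + g (f x) = 3 * M - 1"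
    "\<And>x. x \<in> ?V \<Longrightarrow> M + m \<le> g x \<Longrightarrow> g (f x) < M"
    "\<And>x. x \<in> ?V \<Longrightarrow> m > 0 \<Longrightarrow> g x = M + m \<Longrightarrow> g (f x) < m"
    by (rule ex_labelling[OF fin card f]) (assumption | rule that)+
  \<comment> \<open>\<open>\<phi>\<close> sends \<open>x\<close> to the configuration of value
    \<open>g x\<close>; conjugating by it turns the labels of \<open>f\<close> into binary values
    for \<open>h\<close>.\<close>
  define \<phi> where "\<phi> = inv_into ?V vec_val \<circ> g"
  have \<phi>: "bij_betw \<phi> ?V ?V" unfolding \<phi>_def using g bij_betw_inv_into[OF val] by (rule bij_betw_trans)
  define \<psi> where "\<psi> = inv_into ?V \<phi>"
  have \<psi>: "bij_betw \<psi> ?V ?V" unfolding \<psi>_def using \<phi> by (rule bij_betw_inv_into)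
  have \<psi>V: "\<psi> x \<in> ?V" if "x \<in> ?V" for x using \<psi> that by (auto simp: bij_betw_def)
  have fV: "f x \<in> ?V" if "x \<in> ?V" for x using f(1) that by (auto simp: bij_betw_def)
  have \<phi>V: "\<phi> x \<in> ?V" if "x \<in> ?V" for x using \<phi> that by (auto simp: bij_betw_def)
  have \<phi>\<psi>: "\<phi> (\<psi> x) = x" if "x \<in> ?V" for x
    using \<phi> that unfolding \<psi>_def by (rule bij_betw_inv_into_right)
  have \<psi>\<phi>: "\<psi> (\<phi> x) = x" if "x \<in> ?V" for x
    using \<phi> that unfolding \<psi>_def by (rule bij_betw_inv_into_left)
  have val_\<phi>: "vec_val (\<phi> x) = g x" if "x \<in> ?V" for x
    using g that bij_betw_inv_into_right[OF val, of "g x"] by (auto simp: \<phi>_def bij_betw_def)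
  define h where "h = restrict (\<lambda>x. \<phi> (f (\<psi> x))) ?V"
  have hV: "h x \<in> ?V" if "x \<in> ?V" for x using that \<psi>V fV \<phi>V by (simp add: h_def)
  have val_g: "vec_val x = g (\<psi> x)" "vec_val (h x) = g (f (\<psi> x))" if "x \<in> ?V" for x
    using that val_\<phi>[of "\<psi> x"] val_\<phi>[of "f (\<psi> x)"] \<phi>\<psi> \<psi>V fV by (auto simp: h_def)
  have "h \<in> boolean_networks n"
    using hV Suc by (auto simp: boolean_networks_def h_def)
  moreover have "isomorphic_networks n h f"
    unfolding Suc
  proof (rule isomorphic_networksI[OF \<psi> hV])
    fix x assume "x \<in> ?V"
    then show "\<psi> (h x) = f (\<psi> x)" using \<psi>\<phi>[OF fV[OF \<psi>V]] by (simp add: h_def)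
  qed
  moreover have "strongly_connected (with_proj (async_graph n h))"
    unfolding Suc
  proof (rule strongly_connected_async_graphI[OF M_def m])
    fix x assume x: "x \<in> ?V"
    show "h x \<in> ?V" by (rule hV[OF x])
    show "m \<le> vec_val x \<Longrightarrow> vec_val x < M \<Longrightarrow> vec_val x + vec_val (h x) = 2 * M - 1"
      "vec_val x < m \<Longrightarrow> vec_val x < vec_val (h x) \<and> vec_val (h x) < M"
      "M \<le> vec_val x \<Longrightarrow> vec_val x < M + m \<Longrightarrow> vec_val x + vec_val (h x) = 3 * M - 1"
      "M + m \<le> vec_val x \<Longrightarrow> vec_val (h x) < M"
      "m > 0 \<Longrightarrow> vec_val x = M + m \<Longrightarrow> vec_val (h x) < m"
      unfolding val_g[OF x] by (fact lab[OF \<psi>V[OF x]])+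
  qed
  ultimately show ?thesis by blast
qed

end
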